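(* Let $s,\tau\in\mathbb{N}$, let a matrix $A\in\mathbb{R}^{s\times\tau}$, an integer $m\in\mathbb{N}$, a prime $b$, and integers (reduction indices) $0=w_1\le w_2\le\cdots\le w_s$ be given. Let $\boldsymbol{z}=(z_1,b^{w_2}z_2,\ldots,b^{w_s}z_s)$ be the generating vector of a reduced lattice rule with $N=b^m$ points corresponding to these reduction indices, let $X$ be the $N\times s$ matrix whose rows are the $N$ reduced lattice points, and let $s^*:=\max\{j\in\{1,\ldots,s\}: w_j<m\}$. Then the matrix product $P=XA$ can be computed via the fast reduced matrix product algorithm (described in the context) using $$\mathcal{O}\Big(\tau\,N\sum_{j=1}^{s^*}b^{-w_j}\Big)$$ operations and requiring $\mathcal{O}(N\tau)$ storage.
   Context: Reduced lattice points. For an integer $w\ge 0$ let $\mathbb{U}_{b^{m-w}}=\{z\in\{1,\ldots,b^{m-w}-1\}:\gcd(z,b)=1\}$ if $w<m$ and $\mathbb{U}_{b^{m-w}}=\{1\}$ if $w\ge m$. A generating vector of a reduced lattice rule corresponding to $N=b^m$ and reduction indices $0=w_1\le\cdots\le w_s$ is a vector $(z_1b^{w_1},\ldots,z_sb^{w_s})$ with $z_j\in\mathbb{U}_{b^{m-w_j}}$ for all $j$. The reduced lattice points are $$\boldsymbol{x}_k=\Big(\Big\{\frac{kz_1b^{w_1}}{N}\Big\},\ldots,\Big\{\frac{kz_sb^{w_s}}{N}\Big\}\Big),\qquad k=0,1,\ldots,N-1,$$ where $\{y\}=y-\lfloor y\rfloor$; $\boldsymbol{x}_k$ is the row of $X$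 with index $k$. Fast reduced matrix product algorithm. Input: $A$ (with $j$-th row $\boldsymbol{a}_j\in\mathbb{R}^{1\times\tau}$), $m$, $b$, the $w_j$, and $\boldsymbol{z}$. Set $P_{s^*+1}=\boldsymbol{0}\in\mathbb{R}^{1\times\tau}$. For $j=s^*,s^*-1,\ldots,1$: (i) compute the column vector $$X_j=\Big(0,\frac{z_j\bmod b^{m-w_j}}{b^{m-w_j}},\ldots,\frac{(b^{m-w_j}-1)z_j\bmod b^{m-w_j}}{b^{m-w_j}}\Big)^\top\in\mathbb{R}^{b^{m-w_j}\times 1};$$ (ii) compute $P_j\in\mathbb{R}^{b^{m-w_j}\times\tau}$ as the matrix obtained by stacking $b^{\min(w_{j+1},m)-w_j}$ copies of $P_{j+1}$ vertically, plus $X_j\boldsymbol{a}_j$ (for $j=s^*$ the number of copies is $b^{m-w_{s^*}}$, i.e. $\min(w_{s^*+1},m)$ is read as $m$). Return $P=P_1$. Operations are elementary arithmetic operations on numbers (each of unit cost); storage is counted as the number of numbers stored simultaneously, apart from the input. The $\mathcal{O}$-constants are independent of $s,\tau,m,b,A$, the $w_j$ and $\boldsymbol{z}$. *)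

theory Defs
  imports "Jordan_Normal_Form.Matrix" "HOL-Computational_Algebra.Primes"
begin

section \<open>Reduced lattice points\<close>

text \<open>
  The tuples \<open>(w\<^sub>1, \<dots>, w\<^sub>s)\<close> and \<open>(z\<^sub>1, \<dots>, z\<^sub>s)\<close> are functions on \<^typ>\<open>nat\<close> of which only the
  values at \<open>1, \<dots>, s\<close> are meaningful. Vectors and matrices are indexed from \<open>0\<close>, so row \<open>j\<close> of
  \<open>A\<close> in the mathematical numbering is \<open>row A (j - 1)\<close>.
\<close>

definition reduced_units :: "nat \<Rightarrow> nat \<Rightarrow> nat \<Rightarrow> nat set" where
  "reduced_units b m w =
     (if w < m then {z \<in> {1..b ^ (m - w) - 1}. gcd z b = 1} else {1})"

definition generating_vector :: "nat \<Rightarrow> nat \<Rightarrow> (nat \<Rightarrow> nat) \<Rightarrow> (nat \<Rightarrow> nat) \<Rightarrow> nat vec" where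
  "generating_vector b s w z = vec s (\<lambda>i. z (i + 1) * b ^ w (i + 1))"

definition lattice_point :: "nat \<Rightarrow> nat vec \<Rightarrow> nat \<Rightarrow> real vec" where
  "lattice_point N g k = vec (dim_vec g) (\<lambda>i. frac (real (k * g $ i) / real N))"

definition reduced_lattice_matrix ::
    "nat \<Rightarrow> nat \<Rightarrow> nat \<Rightarrow> (nat \<Rightarrow> nat) \<Rightarrow> (nat \<Rightarrow> nat) \<Rightarrow> real mat" where
  "reduced_lattice_matrix b m s w z =
     mat_of_rows s (map (lattice_point (b ^ m) (generating_vector b s w z)) [0..<b ^ m])"

definition s_star :: "nat \<Rightarrow> nat \<Rightarrow> (nat \<Rightarrow> nat) \<Rightarrow> nat" where
  "s_star m s w = Max {j \<in> {1..s}. w j < m}"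


section \<open>The fast reduced matrix product as a function on matrices\<close>

definition stack_copies :: "nat \<Rightarrow> real mat \<Rightarrow> real mat" where
  "stack_copies c P =
     mat (c * dim_row P) (dim_col P) (\<lambda>(k, l). P $$ (k mod dim_row P, l))"

definition X_col :: "nat \<Rightarrow> nat \<Rightarrow> nat \<Rightarrow> nat \<Rightarrow> real mat" where
  "X_col b m w z =
     mat (b ^ (m - w)) 1 (\<lambda>(k, _). real (k * z mod b ^ (m - w)) / real (b ^ (m - w)))"

definition copies :: "nat \<Rightarrow> nat \<Rightarrow> nat \<Rightarrow> (nat \<Rightarrow> nat) \<Rightarrow> nat \<Rightarrow> nat" where
  "copies b m s w j =
     b ^ ((if j = s_star m s w then m else min (w (j + 1)) m) - w j)"

definition fast_step ::
    "nat \<Rightarrow> nat \<Rightarrow> nat \<Rightarrow> (nat \<Rightarrow> nat) \<Rightarrow> (nat \<Rightarrow> nat) \<Rightarrow> real mat \<Rightarrow> nat \<Rightarrow> real mat \<Rightarrow> real mat" where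
  "fast_step b m s w z A j P =
     stack_copies (copies b m s w j) P + X_col b m (w j) (z j) * mat_of_row (row A (j - 1))"

definition fast_product ::
    "nat \<Rightarrow> nat \<Rightarrow> nat \<Rightarrow> nat \<Rightarrow> (nat \<Rightarrow> nat) \<Rightarrow> (nat \<Rightarrow> nat) \<Rightarrow> real mat \<Rightarrow> real mat" where
  "fast_product b m s \<tau> w z A =
     fold (fast_step b m s w z A) (rev [1..<s_star m s w + 1]) (0\<^sub>m 1 \<tau>)"


section \<open>A unit-cost machine\<close>

text \<open>
  The number of operations and the storage of the algorithm are those of an imperative program,
  run on a machine whose read-only input is separate from its storage. The storage consists of
  finitely many scalars and of matrix variables of dynamic size.
\<close>

record input =
  in_b :: nat
  in_m :: nat
  in_s :: nat
  in_tau :: nat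
  in_w :: "nat \<Rightarrow> nat"
  in_z :: "nat \<Rightarrow> nat"
  in_A :: "real mat"

datatype svar = J | I | K | L | R | Rprev
datatype mvar = MX | MP | MQ

lemma UNIV_svar: "(UNIV :: svar set) = {J, I, K, L, R, Rprev}"
  using svar.exhaust by auto

lemma UNIV_mvar: "(UNIV :: mvar set) = {MX, MP, MQ}"
  using mvar.exhaust by auto

record store =
  scal :: "svar \<Rightarrow> nat"
  mats :: "mvar \<Rightarrow> real mat"

definition empty_store :: store where
  "empty_store = \<lparr>scal = (\<lambda>_. 0), mats = (\<lambda>_. 0\<^sub>m 0 0)\<rparr>"

definition stored :: "store \<Rightarrow> nat" where
  "stored \<sigma> =
     card (UNIV :: svar set) + (\<Sum>v\<in>UNIV. dim_row (mats \<sigma> v) * dim_col (mats \<sigma> v))"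

datatype nexp =
    Num nat | Var svar | InB | InM | InS | InTau | InW nexp | InZ nexp
  | Plus nexp nexp | Minus nexp nexp | Times nexp nexp | Mod nexp nexp

datatype rexp =
    Quot nexp nexp | Entry mvar nexp nexp | InA nexp nexp
  | RPlus rexp rexp | RTimes rexp rexp

datatype bexp = Less nexp nexp | And bexp bexp

primrec nval :: "input \<Rightarrow> store \<Rightarrow> nexp \<Rightarrow> nat" where
  "nval inp \<sigma> (Num n) = n"
| "nval inp \<sigma> (Var x) = scal \<sigma> x"
| "nval inp \<sigma> InB = in_b inp"
| "nval inp \<sigma> InM = in_m inp"
| "nval inp \<sigma> InS = in_s inp"
| "nval inp \<sigma> InTau = in_tau inp"
| "nval inp \<sigma> (InW e) = in_w inp (nval inp \<sigma> e)"
| "nval inp \<sigma> (InZ e) = in_z inp (nval inp \<sigma> e)"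
| "nval inp \<sigma> (Plus e f) = nval inp \<sigma> e + nval inp \<sigma> f"
| "nval inp \<sigma> (Minus e f) = nval inp \<sigma> e - nval inp \<sigma> f"
| "nval inp \<sigma> (Times e f) = nval inp \<sigma> e * nval inp \<sigma> f"
| "nval inp \<sigma> (Mod e f) = nval inp \<sigma> e mod nval inp \<sigma> f"

primrec rval :: "input \<Rightarrow> store \<Rightarrow> rexp \<Rightarrow> real" where
  "rval inp \<sigma> (Quot e f) = real (nval inp \<sigma> e) / real (nval inp \<sigma> f)"
| "rval inp \<sigma> (Entry v e f) = mats \<sigma> v $$ (nval inp \<sigma> e, nval inp \<sigma> f)"
| "rval inp \<sigma> (InA e f) = in_A inp $$ (nval inp \<sigma> e, nval inp \<sigma> f)"
| "rval inp \<sigma> (RPlus p q) = rval inp \<sigma> p + rval inp \<sigma> q"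
| "rval inp \<sigma> (RTimes p q) = rval inp \<sigma> p * rval inp \<sigma> q"

primrec bval :: "input \<Rightarrow> store \<Rightarrow> bexp \<Rightarrow> bool" where
  "bval inp \<sigma> (Less e f) \<longleftrightarrow> nval inp \<sigma> e < nval inp \<sigma> f"
| "bval inp \<sigma> (And c d) \<longleftrightarrow> bval inp \<sigma> c \<and> bval inp \<sigma> d"

text \<open>
  Every arithmetic operation and comparison costs one, index arithmetic included.
\<close>

primrec nops :: "nexp \<Rightarrow> nat" where
  "nops (Num n) = 0"
| "nops (Var x) = 0"
| "nops InB = 0"
| "nops InM = 0"
| "nops InS = 0"
| "nops InTau = 0"
| "nops (InW e) = nops e"
| "nops (InZ e) = nops e"
| "nops (Plus e f) = nops e + nops f + 1"
| "nops (Minus e f) = nops e + nops f + 1"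
| "nops (Times e f) = nops e + nops f + 1"
| "nops (Mod e f) = nops e + nops f + 1"

primrec rops :: "rexp \<Rightarrow> nat" where
  "rops (Quot e f) = nops e + nops f + 1"
| "rops (Entry v e f) = nops e + nops f"
| "rops (InA e f) = nops e + nops f"
| "rops (RPlus p q) = rops p + rops q + 1"
| "rops (RTimes p q) = rops p + rops q + 1"

primrec bops :: "bexp \<Rightarrow> nat" where
  "bops (Less e f) = nops e + nops f + 1"
| "bops (And c d) = bops c + bops d + 1"

datatype com =
    Assign svar nexp                (\<open>_ ::= _\<close> [1000, 61] 61)
  | SetEntry mvar nexp nexp rexp
  | New mvar nexp nexp
  | Move mvar mvar
  | Seq com com                     (infixr \<open>;;\<close> 60)
  | While bexp com

definition set_entry :: "real mat \<Rightarrow> nat \<Rightarrow> nat \<Rightarrow> real \<Rightarrow> real mat" where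
  "set_entry M i j x =
     mat (dim_row M) (dim_col M) (\<lambda>(i', j'). if i' = i \<and> j' = j then x else M $$ (i', j'))"

text \<open>
  \<open>run inp c \<sigma> t M \<sigma>'\<close>: started in \<open>\<sigma>\<close>, the command \<open>c\<close> terminates in \<open>\<sigma>'\<close> after \<open>t\<close> operations, and
  at most \<open>M\<close> numbers are stored at any moment, \<open>M\<close> being attained. On top of the operations in
  expressions, each number written is charged one operation, so \<open>t\<close> is an upper bound for the
  number of arithmetic operations proper. The intermediate results of an expression are charged
  as storage while it is evaluated, one number for each of its operations. \<open>New\<close> replaces a
  matrix by a zero matrix of the given size; \<open>New v (Num 0) (Num 0)\<close> thus releases \<open>v\<close>.
  \<open>Move u v\<close> hands the contents of \<open>v\<close> over to \<open>u\<close> without copying and leaves \<open>v\<close> empty.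
\<close>

inductive run :: "input \<Rightarrow> com \<Rightarrow> store \<Rightarrow> nat \<Rightarrow> nat \<Rightarrow> store \<Rightarrow> bool" for inp where
  Assign:
    "run inp (x ::= e) \<sigma> (nops e + 1) (stored \<sigma> + nops e)
       (\<sigma>\<lparr>scal := (scal \<sigma>)(x := nval inp \<sigma> e)\<rparr>)"
| SetEntry:
    "i = nval inp \<sigma> e \<Longrightarrow> j = nval inp \<sigma> f \<Longrightarrow>
     i < dim_row (mats \<sigma> v) \<Longrightarrow> j < dim_col (mats \<sigma> v) \<Longrightarrow>
     t = nops e + nops f + rops p \<Longrightarrow>
     run inp (SetEntry v e f p) \<sigma> (t + 1) (stored \<sigma> + t)
       (\<sigma>\<lparr>mats := (mats \<sigma>)(v := set_entry (mats \<sigma> v) i j (rval inp \<sigma> p))\<rparr>)"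
| New:
    "r = nval inp \<sigma> e \<Longrightarrow> c = nval inp \<sigma> f \<Longrightarrow> t = nops e + nops f \<Longrightarrow>
     \<sigma>' = \<sigma>\<lparr>mats := (mats \<sigma>)(v := 0\<^sub>m r c)\<rparr> \<Longrightarrow>
     run inp (New v e f) \<sigma> (t + r * c) (max (stored \<sigma> + t) (stored \<sigma>')) \<sigma>'"
| Move:
    "u \<noteq> v \<Longrightarrow>
     run inp (Move u v) \<sigma> 1 (stored \<sigma>)
       (\<sigma>\<lparr>mats := (mats \<sigma>)(u := mats \<sigma> v, v := 0\<^sub>m 0 0)\<rparr>)"
| Seq:
    "run inp c\<^sub>1 \<sigma>\<^sub>1 t\<^sub>1 M\<^sub>1 \<sigma>\<^sub>2 \<Longrightarrow> run inp c\<^sub>2 \<sigma>\<^sub>2 t\<^sub>2 M\<^sub>2 \<sigma>\<^sub>3 \<Longrightarrow>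
     run inp (c\<^sub>1 ;; c\<^sub>2) \<sigma>\<^sub>1 (t\<^sub>1 + t\<^sub>2) (max M\<^sub>1 M\<^sub>2) \<sigma>\<^sub>3"
| WhileFalse:
    "\<not> bval inp \<sigma> g \<Longrightarrow>
     run inp (While g c) \<sigma> (bops g) (stored \<sigma> + bops g) \<sigma>"
| WhileTrue:
    "bval inp \<sigma>\<^sub>1 g \<Longrightarrow> run inp c \<sigma>\<^sub>1 t\<^sub>1 M\<^sub>1 \<sigma>\<^sub>2 \<Longrightarrow> run inp (While g c) \<sigma>\<^sub>2 t\<^sub>2 M\<^sub>2 \<sigma>\<^sub>3 \<Longrightarrow>
     run inp (While g c) \<sigma>\<^sub>1 (bops g + t\<^sub>1 + t\<^sub>2)
       (max (stored \<sigma>\<^sub>1 + bops g) (max M\<^sub>1 M\<^sub>2)) \<sigma>\<^sub>3"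

inductive_cases AssignE: "run inp (x ::= e) \<sigma> t M \<sigma>'"
inductive_cases SetEntryE: "run inp (SetEntry v e f p) \<sigma> t M \<sigma>'"
inductive_cases NewE: "run inp (New v e f) \<sigma> t M \<sigma>'"
inductive_cases MoveE: "run inp (Move u v) \<sigma> t M \<sigma>'"
inductive_cases SeqE: "run inp (c ;; d) \<sigma> t M \<sigma>'"
inductive_cases WhileE: "run inp (While g c) \<sigma> t M \<sigma>'"

lemma run_deterministic:
  assumes "run inp c \<sigma> t M \<sigma>'" and "run inp c \<sigma> t' M' \<sigma>''"
  shows "t' = t \<and> M' = M \<and> \<sigma>'' = \<sigma>'"
  using assms
proof (induction arbitrary: t' M' \<sigma>'' rule: run.induct)
  case (Assign x e \<sigma>)
  then show ?case by (rule AssignE) simp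
next
  case SetEntry
  from SetEntry.prems show ?case by (rule SetEntryE) (simp add: SetEntry.hyps)
next
  case New
  from New.prems show ?case by (rule NewE) (simp add: New.hyps)
next
  case Move
  from Move.prems show ?case by (rule MoveE) simp
next
  case (Seq c\<^sub>1 \<sigma>\<^sub>1 t\<^sub>1 M\<^sub>1 \<sigma>\<^sub>2 c\<^sub>2 t\<^sub>2 M\<^sub>2 \<sigma>\<^sub>3)
  from Seq.prems show ?case
  proof (rule SeqE)
    fix u\<^sub>1 u\<^sub>2 N\<^sub>1 N\<^sub>2 \<rho>
    assume *: "t' = u\<^sub>1 + u\<^sub>2" "M' = max N\<^sub>1 N\<^sub>2"
      and r1: "run inp c\<^sub>1 \<sigma>\<^sub>1 u\<^sub>1 N\<^sub>1 \<rho>" and r2: "run inp c\<^sub>2 \<rho> u\<^sub>2 N\<^sub>2 \<sigma>''"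
    from Seq.IH(1)[OF r1] r2 have "run inp c\<^sub>2 \<sigma>\<^sub>2 u\<^sub>2 N\<^sub>2 \<sigma>''" by simp
    from Seq.IH(1)[OF r1] Seq.IH(2)[OF this] * show ?thesis by simp
  qed
next
  case WhileFalse
  from WhileFalse.prems show ?case by (rule WhileE) (simp_all add: WhileFalse.hyps)
next
  case (WhileTrue \<sigma>\<^sub>1 g c t\<^sub>1 M\<^sub>1 \<sigma>\<^sub>2 t\<^sub>2 M\<^sub>2 \<sigma>\<^sub>3)
  from WhileTrue.prems show ?case
  proof (rule WhileE)
    assume "\<not> bval inp \<sigma>\<^sub>1 g"
    with WhileTrue.hyps show ?thesis by simp
  next
    fix u\<^sub>1 N\<^sub>1 \<rho> u\<^sub>2 N\<^sub>2
    assume *: "t' = bops g + u\<^sub>1 + u\<^sub>2" "M' = max (stored \<sigma>\<^sub>1 + bops g) (max N\<^sub>1 N\<^sub>2)"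
      and r1: "run inp c \<sigma>\<^sub>1 u\<^sub>1 N\<^sub>1 \<rho>" and r2: "run inp (While g c) \<rho> u\<^sub>2 N\<^sub>2 \<sigma>''"
    from WhileTrue.IH(1)[OF r1] r2 have "run inp (While g c) \<sigma>\<^sub>2 u\<^sub>2 N\<^sub>2 \<sigma>''" by simp
    from WhileTrue.IH(1)[OF r1] WhileTrue.IH(2)[OF this] * show ?thesis by simp
  qed
qed


section \<open>The fast reduced matrix product as a program\<close>

text \<open>\<open>J := s\<^sup>*\<close>, using that the \<open>w\<^sub>j\<close> are nondecreasing and that \<open>w\<^sub>1 = 0 < m\<close>\<close>

definition find_s_star :: com where
  "find_s_star =
     J ::= Num 1 ;;
     While (And (Less (Var J) InS) (Less (InW (Plus (Var J) (Num 1))) InM))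
       (J ::= Plus (Var J) (Num 1))"

text \<open>\<open>R := b ^ (m - w\<^sub>J)\<close>\<close>

definition compute_rows :: com where
  "compute_rows =
     R ::= Num 1 ;;
     I ::= InW (Var J) ;;
     While (Less (Var I) InM)
       (R ::= Times (Var R) InB ;;
        I ::= Plus (Var I) (Num 1))"

text \<open>\<open>MX := X\<^sub>J\<close>\<close>

definition compute_X :: com where
  "compute_X =
     New MX (Var R) (Num 1) ;;
     K ::= Num 0 ;;
     While (Less (Var K) (Var R))
       (SetEntry MX (Var K) (Num 0) (Quot (Mod (Times (Var K) (InZ (Var J))) (Var R)) (Var R)) ;;
        K ::= Plus (Var K) (Num 1))"

text \<open>
  \<open>MP := P\<^sub>J\<close>, where \<open>MP\<close> holds \<open>P\<^bsub>J+1\<^esub>\<close> before and \<open>Rprev\<close> its number of rows. Row \<open>k\<close> of the stacked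
  copies of \<open>P\<^bsub>J+1\<^esub>\<close> is read off as row \<open>k mod Rprev\<close> of \<open>P\<^bsub>J+1\<^esub>\<close>.
\<close>

definition compute_P :: com where
  "compute_P =
     New MQ (Var R) InTau ;;
     K ::= Num 0 ;;
     While (Less (Var K) (Var R))
       (L ::= Num 0 ;;
        While (Less (Var L) InTau)
          (SetEntry MQ (Var K) (Var L)
             (RPlus (Entry MP (Mod (Var K) (Var Rprev)) (Var L))
                    (RTimes (Entry MX (Var K) (Num 0)) (InA (Minus (Var J) (Num 1)) (Var L)))) ;;
           L ::= Plus (Var L) (Num 1)) ;;
        K ::= Plus (Var K) (Num 1)) ;;
     Move MP MQ ;;
     New MX (Num 0) (Num 0) ;;
     Rprev ::= Var R"

definition fast_program :: com where
  "fast_program =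
     find_s_star ;;
     New MP (Num 1) InTau ;;
     Rprev ::= Num 1 ;;
     While (Less (Num 0) (Var J))
       (compute_rows ;;
        compute_X ;;
        compute_P ;;
        J ::= Minus (Var J) (Num 1))"

end

theory Submission
  imports Defs
begin

text \<open>
  The \<open>i\<close>-th coordinate of the \<open>k\<close>-th lattice point is \<open>(k z\<^sub>i mod b\<^bsup>m-w\<^sub>i\<^esup>) / b\<^bsup>m-w\<^sub>i\<^esup>\<close>. It vanishes
  for \<open>i > s\<^sup>*\<close>, and since the \<open>w\<^sub>i\<close> are nondecreasing it has period \<open>b\<^bsup>m-w\<^sub>j\<^esup>\<close> in \<open>k\<close> for every
  \<open>j \<le> i\<close>. Hence row \<open>k\<close> of \<open>P\<^sub>j\<close> is the sum over \<open>i = j, \<dots>, s\<^sup>*\<close> of these coordinates times the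
  rows of \<open>A\<close>, and \<open>P\<^sub>1 = X A\<close>. Round \<open>j\<close> is dominated by writing the \<open>b\<^bsup>m-w\<^sub>j\<^esup> \<tau>\<close> entries of
  \<open>P\<^sub>j\<close>; the remaining work is absorbed by \<open>m - w\<^sub>j \<le> b\<^bsup>m-w\<^sub>j\<^esup>\<close> (computing the power) and
  \<open>s\<^sup>* \<le> \<Sum>\<^sub>j b\<^bsup>m-w\<^sub>j\<^esup>\<close> (finding \<open>s\<^sup>*\<close>). Only \<open>P\<^sub>j\<close>, \<open>P\<^bsub>j+1\<^esub>\<close> and \<open>X\<^sub>j\<close> are stored at a time.
\<close>

section \<open>Execution with resource bounds\<close>

text \<open>A total-correctness triple with upper bounds: \<open>run\<close> fixes the exact time
  and peak storage, but only estimates are wanted. Times add under sequencing while peak storage is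
  a maximum, so one \<open>B\<close> passes unchanged through all rules.\<close>

definition achieves ::
    "input \<Rightarrow> com \<Rightarrow> store \<Rightarrow> nat \<Rightarrow> nat \<Rightarrow> (store \<Rightarrow> bool) \<Rightarrow> bool" where
  "achieves inp c \<sigma> T B Q \<longleftrightarrow> (\<exists>t M \<sigma>'. run inp c \<sigma> t M \<sigma>' \<and> t \<le> T \<and> M \<le> B \<and> Q \<sigma>')"

lemma stored_eq:
  "stored \<sigma> = 6 + dim_row (mats \<sigma> MX) * dim_col (mats \<sigma> MX)
     + dim_row (mats \<sigma> MP) * dim_col (mats \<sigma> MP) + dim_row (mats \<sigma> MQ) * dim_col (mats \<sigma> MQ)"
  by (simp add: stored_def UNIV_svar UNIV_mvar)

lemma dim_set_entry [simp]:
  "dim_row (set_entry M i j x) = dim_row M" "dim_col (set_entry M i j x) = dim_col M"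
  by (simp_all add: set_entry_def)

lemma achieves_weaken:
  assumes "achieves inp c \<sigma> T B Q" and "T \<le> T'" and "\<And>\<sigma>'. Q \<sigma>' \<Longrightarrow> Q' \<sigma>'"
  shows "achieves inp c \<sigma> T' B Q'"
  using assms unfolding achieves_def by (meson order_trans)

section \<open>Proof rules for the commands\<close>

lemma achieves_Assign:
  assumes "nops e + 1 \<le> T" and "stored \<sigma> + nops e \<le> B"
    and "Q (\<sigma>\<lparr>scal := (scal \<sigma>)(x := nval inp \<sigma> e)\<rparr>)"
  shows "achieves inp (x ::= e) \<sigma> T B Q"
  unfolding achieves_def using run.Assign assms by blast

lemma achieves_SetEntry:
  assumes "nval inp \<sigma> e < dim_row (mats \<sigma> v)" and "nval inp \<sigma> f < dim_col (mats \<sigma> v)"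
    and "nops e + nops f + rops p + 1 \<le> T" and "stored \<sigma> + (nops e + nops f + rops p) \<le> B"
    and "Q (\<sigma>\<lparr>mats := (mats \<sigma>)(v :=
           set_entry (mats \<sigma> v) (nval inp \<sigma> e) (nval inp \<sigma> f) (rval inp \<sigma> p))\<rparr>)"
  shows "achieves inp (SetEntry v e f p) \<sigma> T B Q"
  unfolding achieves_def using run.SetEntry[OF refl refl assms(1,2) refl] assms(3-) by blast

lemma achieves_New:
  assumes "nops e + nops f + nval inp \<sigma> e * nval inp \<sigma> f \<le> T"
    and "stored \<sigma> + (nops e + nops f) \<le> B"
    and "stored (\<sigma>\<lparr>mats := (mats \<sigma>)(v := 0\<^sub>m (nval inp \<sigma> e) (nval inp \<sigma> f))\<rparr>) \<le> B"
    and "Q (\<sigma>\<lparr>mats := (mats \<sigma>)(v := 0\<^sub>m (nval inp \<sigma> e) (nval inp \<sigma> f))\<rparr>)"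
  shows "achieves inp (New v e f) \<sigma> T B Q"
  unfolding achieves_def using run.New[OF refl refl refl refl] assms
  by (meson max.boundedI)

lemma achieves_Move:
  assumes "u \<noteq> v" and "1 \<le> T" and "stored \<sigma> \<le> B"
    and "Q (\<sigma>\<lparr>mats := (mats \<sigma>)(u := mats \<sigma> v, v := 0\<^sub>m 0 0)\<rparr>)"
  shows "achieves inp (Move u v) \<sigma> T B Q"
  unfolding achieves_def using run.Move assms by blast

lemma achieves_Seq:
  assumes "achieves inp c \<sigma> T B P" and "\<And>\<sigma>'. P \<sigma>' \<Longrightarrow> achieves inp d \<sigma>' T' B Q"
    and "T + T' \<le> T''"
  shows "achieves inp (c ;; d) \<sigma> T'' B Q"
proof -
  obtain t M \<rho> where 1: "run inp c \<sigma> t M \<rho>" "t \<le> T" "M \<le> B" "P \<rho>"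
    using assms(1) unfolding achieves_def by blast
  obtain t' M' \<sigma>' where 2: "run inp d \<rho> t' M' \<sigma>'" "t' \<le> T'" "M' \<le> B" "Q \<sigma>'"
    using assms(2)[OF 1(4)] unfolding achieves_def by blast
  have "t + t' \<le> T''" "max M M' \<le> B" using 1 2 assms(3) by auto
  then show ?thesis using run.Seq[OF 1(1) 2(1)] 2(4) unfolding achieves_def by blast
qed

text \<open>For loops whose number \<open>n\<close> of rounds is known beforehand: the invariant is
  indexed by the rounds completed, which also yields termination. The guard is evaluated
  \<open>n + 1\<close> times, hence the extra \<open>bops g\<close>.\<close>

lemma achieves_While:
  assumes "Inv 0 \<sigma>"
    and body: "\<And>i \<sigma>. i < n \<Longrightarrow> Inv i \<sigma> \<Longrightarrow> bval inp \<sigma> g \<and> achieves inp c \<sigma> (T i) B (Inv (Suc i))"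
    and exit: "\<And>\<sigma>. Inv n \<sigma> \<Longrightarrow> \<not> bval inp \<sigma> g"
    and mem: "\<And>i \<sigma>. i \<le> n \<Longrightarrow> Inv i \<sigma> \<Longrightarrow> stored \<sigma> + bops g \<le> B"
    and time: "(\<Sum>i<n. T i + bops g) + bops g \<le> T'"
    and Q: "\<And>\<sigma>. Inv n \<sigma> \<Longrightarrow> Q \<sigma>"
  shows "achieves inp (While g c) \<sigma> T' B Q"
proof -
  \<comment> \<open>Generalised to a start after \<open>k\<close> completed rounds, for an induction
    from \<open>k = n\<close> downwards.\<close>
  have "achieves inp (While g c) \<sigma> ((\<Sum>i=k..<n. T i + bops g) + bops g) B (Inv n)"
    if "k \<le> n" "Inv k \<sigma>" for k \<sigma>
    using that
  proof (induction arbitrary: \<sigma> rule: inc_induct)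
    case base
    then show ?case
      unfolding achieves_def using run.WhileFalse exit[OF base] mem[OF le_refl base] by force
  next
    case (step k)
    obtain t M \<rho> where 1: "run inp c \<sigma> t M \<rho>" "t \<le> T k" "M \<le> B" "Inv (Suc k) \<rho>"
      and g: "bval inp \<sigma> g"
      using body[OF step.hyps(2) step.prems] unfolding achieves_def by blast
    obtain t' M' \<sigma>' where 2: "run inp (While g c) \<rho> t' M' \<sigma>'"
      "t' \<le> (\<Sum>i=Suc k..<n. T i + bops g) + bops g" "M' \<le> B" "Inv n \<sigma>'"
      using step.IH[OF 1(4)] unfolding achieves_def by blast
    have "bops g + t + t' \<le> (\<Sum>i=k..<n. T i + bops g) + bops g"
      using 1(2) 2(2) step.hyps(2) by (simp add: sum.atLeast_Suc_lessThan)
    moreover have "max (stored \<sigma> + bops g) (max M M') \<le> B"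
      using mem[of k \<sigma>] step.hyps step.prems 1(3) 2(3) by simp
    ultimately show ?case
      using run.WhileTrue[OF g 1(1) 2(1)] 2(4) unfolding achieves_def by blast
  qed
  from this[of 0 \<sigma>] assms(1) time Q show ?thesis
    by (auto intro: achieves_weaken simp: atLeast0LessThan)
qed

text \<open>The state of a matrix filled in row-major order, just before entry \<open>(k, l)\<close> is written\<close>

definition filled :: "nat \<Rightarrow> nat \<Rightarrow> (nat \<Rightarrow> nat \<Rightarrow> real) \<Rightarrow> nat \<Rightarrow> nat \<Rightarrow> real mat" where
  "filled r c f k l = mat r c (\<lambda>(i, j). if i < k \<or> i = k \<and> j < l then f i j else 0)"

lemma dim_filled [simp]: "dim_row (filled r c f k l) = r" "dim_col (filled r c f k l) = c"
  by (simp_all add: filled_def)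

lemma filled_start: "0\<^sub>m r c = filled r c f 0 0"
  by (auto simp: filled_def)

lemma filled_entry: "set_entry (filled r c f k l) k l (f k l) = filled r c f k (Suc l)"
  by (rule eq_matI) (auto simp: filled_def set_entry_def less_Suc_eq)

lemma filled_row: "filled r c f k c = filled r c f (Suc k) 0"
  by (rule eq_matI) (auto simp: filled_def less_Suc_eq)

lemma filled_end: "filled r c f r 0 = mat r c (\<lambda>(i, j). f i j)"
  by (rule eq_matI) (auto simp: filled_def)


section \<open>The partial products\<close>

lemma frac_nat_divide: "frac (real x / real n) = real (x mod n) / real n"
proof (cases "n = 0")
  case False
  \<comment> \<open>Division with remainder splits the quotient into an integer and a rest in [0,
    1).\<close>
  have "real x / real n = real (x mod n) / real n + real_of_int (int (x div n))"
    using False by (simp add: field_simps flip: of_nat_mult of_nat_add)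
  moreover have "real (x mod n) / real n < 1"
    using False by (simp add: field_simps)
  ultimately show ?thesis by (simp add: frac_unique_iff)
qed simp

text \<open>For \<open>w <= m\<close> the factor \<open>b ^ w\<close> cancels against
  \<open>b ^ m\<close>. For \<open>w > m\<close> the numerator is a multiple of
  \<open>b ^ m\<close>, and the right side is 0 too, because \<open>m - w\<close> truncates to 0 and
  everything is 0 modulo 1.\<close>

lemma frac_reduced:
  assumes "b \<noteq> 0"
  shows "frac (real (k * (x * b ^ w)) / real (b ^ m)) =
    real (k * x mod b ^ (m - w)) / real (b ^ (m - w))"
proof (cases "w \<le> m")
  case True
  then have "b ^ m = b ^ (m - w) * b ^ w" by (simp flip: power_add)
  then have "real (k * (x * b ^ w)) / real (b ^ m) = real (k * x) / real (b ^ (m - w))"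
    using assms by simp
  then show ?thesis by (simp only: frac_nat_divide)
next
  case False
  then have "b ^ w = b ^ m * b ^ (w - m)" by (simp flip: power_add)
  then have "k * (x * b ^ w) mod b ^ m = 0" by simp
  then show ?thesis using False by (simp only: frac_nat_divide) simp
qed

locale reduced_lattice =
  fixes s \<tau> :: nat and A :: "real mat" and m b :: nat and w z :: "nat \<Rightarrow> nat"
  assumes s_pos: "1 \<le> s" and tau_pos: "1 \<le> \<tau>" and A_carrier: "A \<in> carrier_mat s \<tau>"
    and m_pos: "1 \<le> m" and b_ge2: "2 \<le> b"
    and w_1: "w 1 = 0" and w_mono: "mono_on {1..s} w"
begin

abbreviation inp :: input where
  "inp \<equiv> \<lparr>in_b = b, in_m = m, in_s = s, in_tau = \<tau>, in_w = w, in_z = z, in_A = A\<rparr>"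

abbreviation S :: nat where
  "S \<equiv> s_star m s w"

definition rows :: "nat \<Rightarrow> nat" where
  "rows j = b ^ (m - w j)"

text \<open>By \<open>frac_reduced\<close> this is coordinate \<open>j\<close> of lattice point
  \<open>k\<close>. It is 0 when \<open>w j >= m\<close>, as then \<open>rows j = 1\<close>.\<close>

definition X_entry :: "nat \<Rightarrow> nat \<Rightarrow> real" where
  "X_entry j k = real (k * z j mod rows j) / real (rows j)"

text \<open>The value \<open>1\<close> is for \<open>j = s\<^sup>* + 1\<close>: the algorithm starts from a single zero row.\<close>

definition partial_rows :: "nat \<Rightarrow> nat" where
  "partial_rows j = (if j \<le> S then rows j else 1)"

text \<open>The recursion of the algorithm unrolled. Since it makes sense for every
  \<open>k\<close>, not only for row indices of \<open>P_j\<close>, stacking copies becomes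
  periodicity in \<open>k\<close>.\<close>

definition partial_entry :: "nat \<Rightarrow> nat \<Rightarrow> nat \<Rightarrow> real" where
  "partial_entry j k l = (\<Sum>i=j..S. X_entry i k * A $$ (i - 1, l))"

definition partial_product :: "nat \<Rightarrow> real mat" where
  "partial_product j = mat (partial_rows j) \<tau> (\<lambda>(k, l). partial_entry j k l)"

section \<open>The index \<open>S\<close> and the heights of the partial products\<close>

lemma s_star: "1 \<le> S" "S \<le> s" "w S < m"
proof -
  \<comment> \<open>The index 1 belongs to the set because \<open>w 1 = 0 < m\<close>, so the
    maximum is attained.\<close>
  have "S \<in> {j \<in> {1..s}. w j < m}"
    unfolding s_star_def using s_pos m_pos w_1 by (intro Max_in) (auto intro!: exI[of _ 1])
  then show "1 \<le> S" "S \<le> s" "w S < m" by auto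
qed

lemma w_less: "1 \<le> j \<Longrightarrow> j \<le> S \<Longrightarrow> w j < m"
  using mono_onD[OF w_mono, of j S] s_star by auto

lemma w_ge: "S < j \<Longrightarrow> j \<le> s \<Longrightarrow> m \<le> w j"
proof (rule ccontr)
  assume "S < j" "j \<le> s" "\<not> m \<le> w j"
  then have "j \<le> S" unfolding s_star_def by (intro Max_ge) auto
  with \<open>S < j\<close> show False by simp
qed

lemma rows_pos: "0 < rows j"
  using b_ge2 by (simp add: rows_def)

text \<open>From \<open>n < 2 ^ n <= b ^ n\<close>. It charges the loop that computes the power
  \<open>b ^ (m - w j)\<close> to the rows of \<open>P_j\<close>.\<close>

lemma m_minus_w_le_rows: "m - w j \<le> rows j"
  using b_ge2 less_exp[of "m - w j"] power_mono[of 2 b "m - w j"] by (simp add: rows_def)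

lemma rows_le: "rows j \<le> b ^ m"
  using b_ge2 by (simp add: rows_def power_increasing)

lemma partial_rows_le: "partial_rows j \<le> b ^ m"
  using b_ge2 rows_le by (simp add: partial_rows_def)

text \<open>A larger reduction index leaves a smaller exponent of \<open>b\<close>. This
  divisibility is what makes stacking whole copies possible.\<close>

lemma rows_dvd: "1 \<le> i \<Longrightarrow> i \<le> j \<Longrightarrow> j \<le> S \<Longrightarrow> rows j dvd rows i"
  unfolding rows_def using mono_onD[OF w_mono, of i j] s_star by (intro le_imp_power_dvd) auto

text \<open>The exponents telescope: \<open>(w (j + 1) - w j) + (m - w (j + 1)) = m - w j\<close>.
  For \<open>j = S\<close> a single zero row is copied, so the number of copies is itself the
  height.\<close>

lemma copies_partial_rows:
  assumes "1 \<le> j" "j \<le> S"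
  shows "copies b m s w j * partial_rows (Suc j) = rows j"
proof (cases "j = S")
  case True
  then show ?thesis by (simp add: copies_def partial_rows_def rows_def)
next
  case False
  then have "w (Suc j) < m" "w j \<le> w (Suc j)"
    using assms s_star w_less[of "Suc j"] mono_onD[OF w_mono, of j "Suc j"] by auto
  then show ?thesis
    using False assms by (simp add: copies_def partial_rows_def rows_def flip: power_add)
qed

text \<open>\<open>rows i\<close> divides \<open>rows j\<close>, so reducing \<open>k\<close> modulo
  \<open>rows j\<close> first does not change residues modulo \<open>rows i\<close>.\<close>

lemma X_entry_mod:
  assumes "1 \<le> j" "j \<le> i" "i \<le> S"
  shows "X_entry i (k mod rows j) = X_entry i k"
proof -
  have "k mod rows j * z i mod rows i = k * z i mod rows i"
    using rows_dvd[OF assms] by (metis mod_mod_cancel mod_mult_left_eq)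
  then show ?thesis by (simp add: X_entry_def)
qed

text \<open>The term \<open>i = j\<close> is split off; all later terms have period
  \<open>partial_rows (Suc j)\<close> in \<open>k\<close>. For \<open>j = S\<close> no later terms
  remain.\<close>

lemma partial_entry_rec:
  assumes "1 \<le> j" "j \<le> S"
  shows "partial_entry j k l =
    partial_entry (Suc j) (k mod partial_rows (Suc j)) l + X_entry j k * A $$ (j - 1, l)"
proof -
  have "partial_entry (Suc j) (k mod partial_rows (Suc j)) l = partial_entry (Suc j) k l"
    unfolding partial_entry_def
    by (intro sum.cong) (auto simp: partial_rows_def X_entry_mod)
  then show ?thesis
    using assms by (simp add: partial_entry_def sum.atLeast_Suc_atMost)
qed

section \<open>The algorithm computes the partial products\<close>

lemma dim_partial_product [simp]:
  "dim_row (partial_product j) = partial_rows j" "dim_col (partial_product j) = \<tau>"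
  by (simp_all add: partial_product_def)

lemma partial_product_end: "partial_product (Suc S) = 0\<^sub>m 1 \<tau>"
  by (rule eq_matI) (auto simp: partial_product_def partial_rows_def partial_entry_def)

text \<open>Entrywise this is \<open>partial_entry_rec\<close>: stacking reads row
  \<open>k mod partial_rows (Suc j)\<close>, and the column times row product has inner dimension
  1.\<close>

lemma fast_step_partial_product:
  assumes "1 \<le> j" "j \<le> S"
  shows "fast_step b m s w z A j (partial_product (Suc j)) = partial_product j"
proof (rule eq_matI)
  fix k l
  assume "k < dim_row (partial_product j)" "l < dim_col (partial_product j)"
  then have k: "k < rows j" and l: "l < \<tau>" using assms by (auto simp: partial_rows_def)
  have pr: "0 < partial_rows (Suc j)" using rows_pos by (simp add: partial_rows_def)
  show "fast_step b m s w z A j (partial_product (Suc j)) $$ (k, l) = partial_product j $$ (k, l)"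
    using assms k l pr A_carrier s_star
    by (simp add: fast_step_def stack_copies_def X_col_def copies_partial_rows partial_product_def
        scalar_prod_def partial_entry_rec[of j] mat_of_row_def X_entry_def partial_rows_def[of j]
        flip: rows_def)
qed (use assms A_carrier in \<open>auto simp: fast_step_def X_col_def partial_rows_def[of j] simp flip: rows_def\<close>)

lemma fast_product_eq: "fast_product b m s \<tau> w z A = partial_product 1"
proof -
  \<comment> \<open>Generalised to a fold stopped after index \<open>j\<close>; the reversed list
    ends in \<open>j\<close>, so the induction runs downwards from \<open>Suc S\<close>.\<close>
  have "fold (fast_step b m s w z A) (rev [j..<Suc S]) (0\<^sub>m 1 \<tau>) = partial_product j"
    if "j \<le> Suc S" "1 \<le> j" for j
    using that
  proof (induction rule: inc_induct)
    case base
    then show ?case by (simp add: partial_product_end)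
  next
    case (step j)
    then show ?case by (simp add: upt_conv_Cons fast_step_partial_product del: upt_Suc)
  qed
  from this[of 1] s_star show ?thesis by (simp add: fast_product_def)
qed

lemma partial_product_1: "partial_product 1 = reduced_lattice_matrix b m s w z * A"
proof (rule eq_matI)
  have rows1: "partial_rows (Suc 0) = b ^ m"
    using s_star w_1 by (simp add: partial_rows_def rows_def)
  show "dim_row (partial_product 1) = dim_row (reduced_lattice_matrix b m s w z * A)"
    by (simp add: rows1 reduced_lattice_matrix_def)
  show "dim_col (partial_product 1) = dim_col (reduced_lattice_matrix b m s w z * A)"
    using A_carrier by simp
  fix k l
  assume "k < dim_row (reduced_lattice_matrix b m s w z * A)"
    "l < dim_col (reduced_lattice_matrix b m s w z * A)"
  then have k: "k < b ^ m" and l: "l < \<tau>"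
    using A_carrier by (auto simp: reduced_lattice_matrix_def)
  have frac: "frac (real k * (real (z i) * real b ^ w i) / real b ^ m) = X_entry i k" for i
    using frac_reduced[of b k "z i" "w i" m] b_ge2 by (simp add: X_entry_def rows_def)
  have "(reduced_lattice_matrix b m s w z * A) $$ (k, l) = (\<Sum>i<s. X_entry (Suc i) k * A $$ (i, l))"
    using k l A_carrier
    by (simp add: reduced_lattice_matrix_def scalar_prod_def lattice_point_def generating_vector_def
        frac atLeast0LessThan)
  also have "\<dots> = (\<Sum>i=1..s. X_entry i k * A $$ (i - 1, l))"
    by (rule sum.reindex_bij_witness[of _ "\<lambda>i. i - 1" Suc]) auto
  \<comment> \<open>For \<open>i > S\<close> the reduction index is at least \<open>m\<close>, so
    \<open>rows i = 1\<close> and the term vanishes.\<close>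
  also have "\<dots> = partial_entry 1 k l"
    unfolding partial_entry_def
    using s_star w_ge by (intro sum.mono_neutral_right) (auto simp: X_entry_def rows_def)
  also have "\<dots> = partial_product 1 $$ (k, l)"
    using k l by (simp add: partial_product_def rows1)
  finally show "partial_product 1 $$ (k, l) = (reduced_lattice_matrix b m s w z * A) $$ (k, l)" ..
qed


section \<open>The program\<close>

text \<open>One storage bound for all phases: two partial products and \<open>X_j\<close> take at
  most 3 times \<open>b ^ m * \<tau>\<close> numbers, and additive constants are absorbed because
  this product is at least 1.\<close>

definition bound :: nat where
  "bound = 20 * (b ^ m * \<tau>)"

section \<open>The phases of the program\<close>

lemma find_s_star_correct:
  assumes "mats \<sigma> = (\<lambda>_. 0\<^sub>m 0 0)"
  shows "achieves inp find_s_star \<sigma> (6 * S) bound (\<lambda>\<sigma>'. mats \<sigma>' = mats \<sigma> \<and> scal \<sigma>' J = S)"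
proof -
  define Inv where "Inv i \<rho> \<longleftrightarrow> mats \<rho> = mats \<sigma> \<and> scal \<rho> J = Suc i" for i and \<rho> :: store
  have "1 \<le> b ^ m * \<tau>" using tau_pos b_ge2 by simp
  then have B: "20 \<le> bound" unfolding bound_def by linarith
  \<comment> \<open>After \<open>i\<close> rounds \<open>J\<close> is \<open>i + 1\<close>, so the
    guard inspects index \<open>i + 2\<close>: by monotonicity it holds below \<open>S\<close>, and
    at \<open>S\<close> either \<open>s\<close> is reached or the next index has
    \<open>w >= m\<close>.\<close>
  have guard: "Suc i < s \<and> w (Suc (Suc i)) < m \<longleftrightarrow> i < S - 1" if "i \<le> S - 1" for i
  proof (cases "i < S - 1")
    case True
    then show ?thesis using s_star w_less[of "Suc (Suc i)"] by simp
  next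
    case False
    then have "Suc i = S" using that s_star by simp
    then show ?thesis using w_ge[of "Suc (Suc i)"] by (auto simp: not_less)
  qed
  have stored: "stored \<rho> = 6" if "mats \<rho> = mats \<sigma>" for \<rho> :: store
    using that assms by (simp add: stored_eq)
  show ?thesis
    unfolding find_s_star_def
  proof (rule achieves_Seq)
    show "achieves inp (J ::= Num 1) \<sigma> 1 bound (Inv 0)"
      using B by (intro achieves_Assign) (auto simp: Inv_def stored)
    fix \<rho> :: store assume "Inv 0 \<rho>"
    then show "achieves inp (While (And (Less (Var J) InS) (Less (InW (Plus (Var J) (Num 1))) InM))
        (J ::= Plus (Var J) (Num 1))) \<rho> (6 * (S - 1) + 4) bound
        (\<lambda>\<sigma>'. mats \<sigma>' = mats \<sigma> \<and> scal \<sigma>' J = S)"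
    proof (rule achieves_While[where n = "S - 1" and T = "\<lambda>_. 2"])
      fix i \<rho>
      assume "i < S - 1" "Inv i \<rho>"
      then show "bval inp \<rho> (And (Less (Var J) InS) (Less (InW (Plus (Var J) (Num 1))) InM)) \<and>
          achieves inp (J ::= Plus (Var J) (Num 1)) \<rho> 2 bound (Inv (Suc i))"
        using B guard[of i] by (auto intro!: achieves_Assign simp: Inv_def stored)
    qed (use B guard[of "S - 1"] s_star in \<open>auto simp: Inv_def stored\<close>)
  qed (use s_star in simp)
qed

text \<open>\<open>R\<close> runs through the powers of \<open>b\<close> while \<open>I\<close>
  climbs from \<open>w j\<close> to \<open>m\<close>, at cost 4 per round and 1 for the guard. If
  \<open>w j >= m\<close>, no round runs and \<open>R = 1\<close> agrees with the truncated
  exponent.\<close>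

lemma compute_rows_correct:
  assumes "stored \<sigma> + 4 \<le> bound" and "scal \<sigma> J = j"
  shows "achieves inp compute_rows \<sigma> (8 * rows j) bound
    (\<lambda>\<sigma>'. mats \<sigma>' = mats \<sigma> \<and> scal \<sigma>' J = j \<and> scal \<sigma>' Rprev = scal \<sigma> Rprev \<and> scal \<sigma>' R = rows j)"
proof -
  define Inv where "Inv i \<rho> \<longleftrightarrow> mats \<rho> = mats \<sigma> \<and> scal \<rho> J = j \<and> scal \<rho> Rprev = scal \<sigma> Rprev \<and>
    scal \<rho> R = b ^ i \<and> scal \<rho> I = w j + i" for i and \<rho> :: store
  obtain n where n: "stored \<sigma> = n" by blast
  then have stored: "stored \<rho> = n" if "mats \<rho> = mats \<sigma>" for \<rho> :: store
    using that by (simp add: stored_eq)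
  show ?thesis
    unfolding compute_rows_def
  proof (rule achieves_Seq)
    show "achieves inp (R ::= Num 1) \<sigma> 1 bound (\<lambda>\<rho>. mats \<rho> = mats \<sigma> \<and> scal \<rho> J = j \<and>
        scal \<rho> Rprev = scal \<sigma> Rprev \<and> scal \<rho> R = 1)"
      using assms n by (intro achieves_Assign) auto
    fix \<rho> :: store
    assume \<rho>: "mats \<rho> = mats \<sigma> \<and> scal \<rho> J = j \<and> scal \<rho> Rprev = scal \<sigma> Rprev \<and> scal \<rho> R = 1"
    show "achieves inp (I ::= InW (Var J) ;; While (Less (Var I) InM)
        (R ::= Times (Var R) InB ;; I ::= Plus (Var I) (Num 1))) \<rho> (5 * (m - w j) + 2) bound
        (\<lambda>\<sigma>'. mats \<sigma>' = mats \<sigma> \<and> scal \<sigma>' J = j \<and> scal \<sigma>' Rprev = scal \<sigma> Rprev \<and> scal \<sigma>' R = rows j)"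
    proof (rule achieves_Seq)
      show "achieves inp (I ::= InW (Var J)) \<rho> 1 bound (Inv 0)"
        using assms n \<rho> by (intro achieves_Assign) (auto simp: Inv_def stored)
      fix \<rho> :: store assume "Inv 0 \<rho>"
      then show "achieves inp (While (Less (Var I) InM)
          (R ::= Times (Var R) InB ;; I ::= Plus (Var I) (Num 1))) \<rho> (5 * (m - w j) + 1) bound
          (\<lambda>\<sigma>'. mats \<sigma>' = mats \<sigma> \<and> scal \<sigma>' J = j \<and> scal \<sigma>' Rprev = scal \<sigma> Rprev \<and>
            scal \<sigma>' R = rows j)"
      proof (rule achieves_While[where n = "m - w j" and T = "\<lambda>_. 4"])
        fix i \<rho>
        assume i: "i < m - w j" and Inv: "Inv i \<rho>"
        have "achieves inp (R ::= Times (Var R) InB ;; I ::= Plus (Var I) (Num 1)) \<rho> 4 bound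
            (Inv (Suc i))"
        proof (rule achieves_Seq)
          show "achieves inp (R ::= Times (Var R) InB) \<rho> 2 bound (\<lambda>\<rho>. mats \<rho> = mats \<sigma> \<and>
              scal \<rho> J = j \<and> scal \<rho> Rprev = scal \<sigma> Rprev \<and> scal \<rho> R = b ^ Suc i \<and>
              scal \<rho> I = w j + i)"
            using assms n Inv by (intro achieves_Assign) (auto simp: Inv_def stored)
          fix \<rho> :: store
          assume "mats \<rho> = mats \<sigma> \<and> scal \<rho> J = j \<and> scal \<rho> Rprev = scal \<sigma> Rprev \<and>
            scal \<rho> R = b ^ Suc i \<and> scal \<rho> I = w j + i"
          then show "achieves inp (I ::= Plus (Var I) (Num 1)) \<rho> 2 bound (Inv (Suc i))"
            using assms n by (intro achieves_Assign) (auto simp: Inv_def stored)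
        qed simp
        then show "bval inp \<rho> (Less (Var I) InM) \<and>
            achieves inp (R ::= Times (Var R) InB ;; I ::= Plus (Var I) (Num 1)) \<rho> 4 bound
              (Inv (Suc i))"
          using i Inv by (simp add: Inv_def)
      qed (use assms n in \<open>auto simp: Inv_def stored rows_def\<close>)
    qed simp
  next
    \<comment> \<open>Both \<open>m - w j\<close> and 1 are at most \<open>rows j\<close>, and 5 + 3
      = 8.\<close>
    show "1 + (5 * (m - w j) + 2) \<le> 8 * rows j"
      using m_minus_w_le_rows[of j] rows_pos[of j] by linarith
  qed
qed

definition X_mat :: "nat \<Rightarrow> real mat" where
  "X_mat j = mat (rows j) 1 (\<lambda>(k, _). X_entry j k)"

text \<open>\<open>MX\<close> starts empty, so the storage grows by exactly \<open>rows j\<close>; 4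
  more numbers leave room for intermediate results.\<close>

lemma compute_X_correct:
  assumes B: "stored \<sigma> + rows j + 4 \<le> bound" and J: "scal \<sigma> J = j" and R: "scal \<sigma> R = rows j"
    and MX: "mats \<sigma> MX = 0\<^sub>m 0 0"
  shows "achieves inp compute_X \<sigma> (10 * rows j) bound
    (\<lambda>\<sigma>'. mats \<sigma>' = (mats \<sigma>)(MX := X_mat j) \<and> scal \<sigma>' J = j \<and> scal \<sigma>' Rprev = scal \<sigma> Rprev \<and>
      scal \<sigma>' R = rows j)"
    (is "achieves _ _ _ _ _ ?Q")
proof -
  define Inv where "Inv k \<rho> \<longleftrightarrow>
    mats \<rho> = (mats \<sigma>)(MX := filled (rows j) 1 (\<lambda>k _. X_entry j k) k 0) \<and> scal \<rho> J = j \<and>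
    scal \<rho> Rprev = scal \<sigma> Rprev \<and> scal \<rho> R = rows j \<and> scal \<rho> K = k" for k and \<rho> :: store
  have stored: "stored \<rho> = stored \<sigma> + rows j"
    if "mats \<rho> = (mats \<sigma>)(MX := filled (rows j) 1 f k l)" for f k l and \<rho> :: store
    using that MX by (simp add: stored_eq)
  let ?c = "SetEntry MX (Var K) (Num 0) (Quot (Mod (Times (Var K) (InZ (Var J))) (Var R)) (Var R))"
  show ?thesis
    unfolding compute_X_def
  proof (rule achieves_Seq)
    show "achieves inp (New MX (Var R) (Num 1)) \<sigma> (rows j) bound (\<lambda>\<rho>.
        mats \<rho> = (mats \<sigma>)(MX := filled (rows j) 1 (\<lambda>k _. X_entry j k) 0 0) \<and> scal \<rho> = scal \<sigma>)"
      using B R MX by (intro achieves_New) (auto simp: stored_eq filled_start)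
    fix \<rho> :: store
    assume \<rho>: "mats \<rho> = (mats \<sigma>)(MX := filled (rows j) 1 (\<lambda>k _. X_entry j k) 0 0) \<and>
      scal \<rho> = scal \<sigma>"
    show "achieves inp (K ::= Num 0 ;; While (Less (Var K) (Var R))
        (?c ;; K ::= Plus (Var K) (Num 1))) \<rho> (7 * rows j + 2) bound ?Q"
    proof (rule achieves_Seq)
      show "achieves inp (K ::= Num 0) \<rho> 1 bound (Inv 0)"
        using B J R \<rho> stored[of \<rho>] by (intro achieves_Assign) (auto simp: Inv_def)
      fix \<rho> :: store assume "Inv 0 \<rho>"
      then show "achieves inp (While (Less (Var K) (Var R)) (?c ;; K ::= Plus (Var K) (Num 1)))
          \<rho> (7 * rows j + 1) bound ?Q"
      proof (rule achieves_While[where n = "rows j" and T = "\<lambda>_. 6"])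
        fix k \<rho>
        assume k: "k < rows j" and Inv: "Inv k \<rho>"
        have "achieves inp (?c ;; K ::= Plus (Var K) (Num 1)) \<rho> 6 bound (Inv (Suc k))"
        proof (rule achieves_Seq)
          \<comment> \<open>With a single column, writing entry \<open>(k, 0)\<close> completes row
            \<open>k\<close>.\<close>
          show "achieves inp ?c \<rho> 4 bound (\<lambda>\<rho>.
              mats \<rho> = (mats \<sigma>)(MX := filled (rows j) 1 (\<lambda>k _. X_entry j k) (Suc k) 0) \<and>
              scal \<rho> J = j \<and> scal \<rho> Rprev = scal \<sigma> Rprev \<and> scal \<rho> R = rows j \<and> scal \<rho> K = k)"
            using B Inv k stored[of \<rho>]
              filled_entry[of "rows j" 1 "\<lambda>k _. X_entry j k" k 0]
              filled_row[of "rows j" 1 "\<lambda>k _. X_entry j k" k]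
            by (intro achieves_SetEntry) (auto simp: Inv_def X_entry_def)
          fix \<rho> :: store
          assume "mats \<rho> = (mats \<sigma>)(MX := filled (rows j) 1 (\<lambda>k _. X_entry j k) (Suc k) 0) \<and>
            scal \<rho> J = j \<and> scal \<rho> Rprev = scal \<sigma> Rprev \<and> scal \<rho> R = rows j \<and> scal \<rho> K = k"
          then show "achieves inp (K ::= Plus (Var K) (Num 1)) \<rho> 2 bound (Inv (Suc k))"
            using B stored[of \<rho>] by (intro achieves_Assign) (auto simp: Inv_def)
        qed simp
        then show "bval inp \<rho> (Less (Var K) (Var R)) \<and>
            achieves inp (?c ;; K ::= Plus (Var K) (Num 1)) \<rho> 6 bound (Inv (Suc k))"
          using k Inv by (simp add: Inv_def)
      next
        fix k \<rho>
        assume "Inv k \<rho>"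
        then show "stored \<rho> + bops (Less (Var K) (Var R)) \<le> bound"
          using B stored[of \<rho>] by (auto simp: Inv_def)
      qed (auto simp: Inv_def filled_end X_mat_def)
    qed simp
  next
    show "rows j + (7 * rows j + 2) \<le> 10 * rows j"
      using rows_pos[of j] by linarith
  qed
qed

text \<open>\<open>P_{j+1}\<close> stays in \<open>MP\<close> while \<open>MQ\<close> is filled with
  \<open>P_j\<close>, so both are stored at once; the move then drops the former without a
  copy.\<close>

lemma compute_P_correct:
  assumes j: "1 \<le> j" "j \<le> S"
    and B: "stored \<sigma> + rows j * \<tau> + 8 \<le> bound" and J: "scal \<sigma> J = j" and R: "scal \<sigma> R = rows j"
    and Rprev: "scal \<sigma> Rprev = partial_rows (Suc j)"
    and MX: "mats \<sigma> MX = X_mat j" and MP: "mats \<sigma> MP = partial_product (Suc j)"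
    and MQ: "mats \<sigma> MQ = 0\<^sub>m 0 0"
  shows "achieves inp compute_P \<sigma> (25 * (rows j * \<tau>)) bound
    (\<lambda>\<sigma>'. mats \<sigma>' MX = 0\<^sub>m 0 0 \<and> mats \<sigma>' MP = partial_product j \<and> mats \<sigma>' MQ = 0\<^sub>m 0 0 \<and>
      scal \<sigma>' J = j \<and> scal \<sigma>' Rprev = rows j)"
    (is "achieves _ _ _ _ _ ?Q")
proof -
  define Inv where "Inv k l \<rho> \<longleftrightarrow>
    mats \<rho> = (mats \<sigma>)(MQ := filled (rows j) \<tau> (partial_entry j) k l) \<and> scal \<rho> J = j \<and>
    scal \<rho> Rprev = partial_rows (Suc j) \<and> scal \<rho> R = rows j \<and> scal \<rho> K = k" for k l and \<rho> :: store
  have stored: "stored \<rho> = stored \<sigma> + rows j * \<tau>" if "Inv k l \<rho>" for \<rho> k l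
    using that MQ by (simp add: stored_eq Inv_def)
  have Rprev_pos: "0 < partial_rows (Suc j)" using rows_pos by (simp add: partial_rows_def)
  let ?c = "SetEntry MQ (Var K) (Var L)
    (RPlus (Entry MP (Mod (Var K) (Var Rprev)) (Var L))
       (RTimes (Entry MX (Var K) (Num 0)) (InA (Minus (Var J) (Num 1)) (Var L))))"
  let ?inner = "While (Less (Var L) InTau) (?c ;; L ::= Plus (Var L) (Num 1))"
  let ?body = "L ::= Num 0 ;; ?inner ;; K ::= Plus (Var K) (Num 1)"
  let ?rest = "Move MP MQ ;; New MX (Num 0) (Num 0) ;; Rprev ::= Var R"
  have inner: "achieves inp ?inner \<rho> (8 * \<tau> + 1) bound (Inv k \<tau>)"
    if k: "k < rows j" and "Inv k 0 \<rho> \<and> scal \<rho> L = 0" for k \<rho>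
    using that(2)
  proof (rule achieves_While[where n = \<tau> and T = "\<lambda>_. 7" and Inv = "\<lambda>l \<rho>. Inv k l \<rho> \<and> scal \<rho> L = l"])
    fix l \<rho>
    assume l: "l < \<tau>" and Inv: "Inv k l \<rho> \<and> scal \<rho> L = l"
    \<comment> \<open>The left side is the value that the assignment computes;
      \<open>partial_entry_rec\<close> identifies it as the entry of \<open>P_j\<close>.\<close>
    have entry: "partial_product (Suc j) $$ (k mod partial_rows (Suc j), l)
        + X_mat j $$ (k, 0) * A $$ (j - Suc 0, l) = partial_entry j k l"
      using j k l Rprev_pos by (simp add: partial_entry_rec[of j] partial_product_def X_mat_def)
    have "achieves inp (?c ;; L ::= Plus (Var L) (Num 1)) \<rho> 7 bound
        (\<lambda>\<rho>. Inv k (Suc l) \<rho> \<and> scal \<rho> L = Suc l)"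
    proof (rule achieves_Seq)
      show "achieves inp ?c \<rho> 5 bound (\<lambda>\<rho>. Inv k (Suc l) \<rho> \<and> scal \<rho> L = l)"
        using B Inv k l stored[of k l \<rho>] MX MP
        by (intro achieves_SetEntry) (auto simp: Inv_def entry filled_entry)
      fix \<rho> :: store
      assume "Inv k (Suc l) \<rho> \<and> scal \<rho> L = l"
      then show "achieves inp (L ::= Plus (Var L) (Num 1)) \<rho> 2 bound
          (\<lambda>\<rho>. Inv k (Suc l) \<rho> \<and> scal \<rho> L = Suc l)"
        using B stored[of k "Suc l" \<rho>] by (intro achieves_Assign) (auto simp: Inv_def)
    qed simp
    then show "bval inp \<rho> (Less (Var L) InTau) \<and> achieves inp (?c ;; L ::= Plus (Var L) (Num 1)) \<rho> 7
        bound (\<lambda>\<rho>. Inv k (Suc l) \<rho> \<and> scal \<rho> L = Suc l)"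
      using l Inv by simp
  next
    fix l \<rho>
    assume "Inv k l \<rho> \<and> scal \<rho> L = l"
    then show "stored \<rho> + bops (Less (Var L) InTau) \<le> bound"
      using B stored[of k l \<rho>] by simp
  qed (auto simp: Inv_def)
  have body: "achieves inp ?body \<rho> (8 * \<tau> + 4) bound (Inv (Suc k) 0)"
    if k: "k < rows j" and Inv: "Inv k 0 \<rho>" for k \<rho>
  proof (rule achieves_Seq)
    show "achieves inp (L ::= Num 0) \<rho> 1 bound (\<lambda>\<rho>. Inv k 0 \<rho> \<and> scal \<rho> L = 0)"
      using B Inv stored[OF Inv] by (intro achieves_Assign) (auto simp: Inv_def)
    fix \<rho> :: store
    assume \<rho>: "Inv k 0 \<rho> \<and> scal \<rho> L = 0"
    show "achieves inp (?inner ;; K ::= Plus (Var K) (Num 1)) \<rho> (8 * \<tau> + 3) bound (Inv (Suc k) 0)"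
    proof (rule achieves_Seq)
      show "achieves inp ?inner \<rho> (8 * \<tau> + 1) bound (Inv k \<tau>)"
        using inner[OF k \<rho>] .
      fix \<rho> :: store
      \<comment> \<open>By \<open>filled_row\<close>, a full row \<open>k\<close> is the same state
        as the empty beginning of row \<open>k + 1\<close>.\<close>
      assume "Inv k \<tau> \<rho>"
      then show "achieves inp (K ::= Plus (Var K) (Num 1)) \<rho> 2 bound (Inv (Suc k) 0)"
        using B stored[of k \<tau> \<rho>] by (intro achieves_Assign) (auto simp: Inv_def filled_row)
    qed simp
  qed simp
  show ?thesis
    unfolding compute_P_def
  proof (rule achieves_Seq)
    show "achieves inp (New MQ (Var R) InTau) \<sigma> (rows j * \<tau>) bound (\<lambda>\<rho>.
        mats \<rho> = (mats \<sigma>)(MQ := filled (rows j) \<tau> (partial_entry j) 0 0) \<and> scal \<rho> = scal \<sigma>)"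
      using B R MQ by (intro achieves_New) (auto simp: stored_eq filled_start)
    fix \<rho> :: store
    assume \<rho>: "mats \<rho> = (mats \<sigma>)(MQ := filled (rows j) \<tau> (partial_entry j) 0 0) \<and>
      scal \<rho> = scal \<sigma>"
    show "achieves inp (K ::= Num 0 ;; While (Less (Var K) (Var R)) ?body ;; ?rest) \<rho>
        (rows j * (8 * \<tau> + 5) + 5) bound ?Q"
    proof (rule achieves_Seq)
      show "achieves inp (K ::= Num 0) \<rho> 1 bound (Inv 0 0)"
        using B J R Rprev MQ \<rho> by (intro achieves_Assign) (auto simp: Inv_def stored_eq)
      fix \<rho> :: store
      assume Inv: "Inv 0 0 \<rho>"
      show "achieves inp (While (Less (Var K) (Var R)) ?body ;; ?rest) \<rho>
          (rows j * (8 * \<tau> + 5) + 4) bound ?Q"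
      proof (rule achieves_Seq)
        show "achieves inp (While (Less (Var K) (Var R)) ?body) \<rho> (rows j * (8 * \<tau> + 5) + 1) bound
            (Inv (rows j) 0)"
        proof (rule achieves_While[where n = "rows j" and T = "\<lambda>_. 8 * \<tau> + 4"
              and Inv = "\<lambda>k. Inv k 0"])
          fix k \<rho>
          assume "k < rows j" "Inv k 0 \<rho>"
          then show "bval inp \<rho> (Less (Var K) (Var R)) \<and>
              achieves inp ?body \<rho> (8 * \<tau> + 4) bound (Inv (Suc k) 0)"
            using body[of k \<rho>] by (simp add: Inv_def)
        next
          fix k \<rho>
          assume "Inv k 0 \<rho>"
          then show "stored \<rho> + bops (Less (Var K) (Var R)) \<le> bound"
            using B stored[of k 0 \<rho>] by simp
        qed (use Inv in \<open>auto simp: Inv_def\<close>)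
        fix \<rho> :: store
        assume \<rho>: "Inv (rows j) 0 \<rho>"
        show "achieves inp ?rest \<rho> 3 bound ?Q"
        proof (rule achieves_Seq)
          show "achieves inp (Move MP MQ) \<rho> 1 bound (\<lambda>\<rho>.
              mats \<rho> = (mats \<sigma>)(MP := partial_product j, MQ := 0\<^sub>m 0 0) \<and> scal \<rho> J = j \<and>
              scal \<rho> R = rows j)"
            using B stored[OF \<rho>] \<rho> j
            by (intro achieves_Move)
              (auto simp: Inv_def filled_end partial_product_def partial_rows_def)
          fix \<rho> :: store
          assume \<rho>: "mats \<rho> = (mats \<sigma>)(MP := partial_product j, MQ := 0\<^sub>m 0 0) \<and> scal \<rho> J = j \<and>
            scal \<rho> R = rows j"
          show "achieves inp (New MX (Num 0) (Num 0) ;; Rprev ::= Var R) \<rho> 1 bound ?Q"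
          proof (rule achieves_Seq)
            show "achieves inp (New MX (Num 0) (Num 0)) \<rho> 0 bound (\<lambda>\<rho>.
                mats \<rho> = (mats \<sigma>)(MP := partial_product j, MQ := 0\<^sub>m 0 0, MX := 0\<^sub>m 0 0) \<and>
                scal \<rho> J = j \<and> scal \<rho> R = rows j)"
              using B \<rho> j by (intro achieves_New) (auto simp: stored_eq partial_rows_def[of j])
            fix \<rho> :: store
            assume "mats \<rho> = (mats \<sigma>)(MP := partial_product j, MQ := 0\<^sub>m 0 0, MX := 0\<^sub>m 0 0) \<and>
                scal \<rho> J = j \<and> scal \<rho> R = rows j"
            then show "achieves inp (Rprev ::= Var R) \<rho> 1 bound ?Q"
              using B j by (intro achieves_Assign) (auto simp: stored_eq partial_rows_def[of j])
          qed simp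
        qed simp
      qed simp
    qed simp
  next
    \<comment> \<open>Allocation and entries cost 1 + 8 per entry; the overhead of 5 per row and the
      constant 5 are absorbed by \<open>\<tau> >= 1\<close> and \<open>rows j >= 1\<close>.\<close>
    have "rows j \<le> rows j * \<tau>" using tau_pos by simp
    moreover have "rows j * (8 * \<tau> + 5) = 8 * (rows j * \<tau>) + 5 * rows j"
      by (simp add: algebra_simps)
    ultimately show "rows j * \<tau> + (rows j * (8 * \<tau> + 5) + 5) \<le> 25 * (rows j * \<tau>)"
      using rows_pos[of j] by linarith
  qed
qed

section \<open>The whole program\<close>

lemma fast_program_correct:
  "achieves inp fast_program empty_store (60 * (\<tau> * (\<Sum>j=1..S. rows j))) bound
     (\<lambda>\<sigma>. mats \<sigma> MP = partial_product 1)"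
proof -
  \<comment> \<open>After \<open>i\<close> rounds \<open>J\<close> is \<open>S - i\<close> and
    \<open>MP\<close> holds \<open>P_{J+1}\<close>: the zero row for \<open>i = 0\<close>, and
    \<open>P_1\<close> for \<open>i = S\<close>.\<close>
  define Inv where "Inv i \<rho> \<longleftrightarrow> mats \<rho> MX = 0\<^sub>m 0 0 \<and> mats \<rho> MP = partial_product (Suc (S - i)) \<and>
    mats \<rho> MQ = 0\<^sub>m 0 0 \<and> scal \<rho> J = S - i \<and> scal \<rho> Rprev = partial_rows (Suc (S - i))"
    for i and \<rho> :: store
  have N: "1 \<le> b ^ m * \<tau>" "b ^ m \<le> b ^ m * \<tau>" "\<tau> \<le> b ^ m * \<tau>"
    using tau_pos b_ge2 by simp_all
  \<comment> \<open>14 consists of the 6 scalars and the 8 numbers of slack required by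
    \<open>compute_P_correct\<close>.\<close>
  have space: "partial_rows i * \<tau> + rows j + rows j * \<tau> + 14 \<le> bound" for i j
  proof -
    have "partial_rows i * \<tau> \<le> b ^ m * \<tau>" "rows j * \<tau> \<le> b ^ m * \<tau>" "rows j \<le> b ^ m * \<tau>"
      using rows_le[of j] partial_rows_le[of i] order_trans[OF rows_le N(2)] by simp_all
    then show ?thesis using N(1) unfolding bound_def by linarith
  qed
  have space_init: "\<tau> + 14 \<le> bound"
    using N(1,3) unfolding bound_def by linarith
  let ?body = "compute_rows ;; compute_X ;; compute_P ;; J ::= Minus (Var J) (Num 1)"
  have body: "achieves inp ?body \<rho> (45 * (rows j * \<tau>)) bound (Inv (Suc i))"
    if i: "i < S" and j: "j = S - i" and Inv: "Inv i \<rho>" for i j \<rho>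
  proof (rule achieves_Seq)
    have stored: "stored \<rho> = 6 + partial_rows (Suc j) * \<tau>"
      using Inv j by (simp add: Inv_def stored_eq)
    show "achieves inp compute_rows \<rho> (8 * rows j) bound (\<lambda>\<rho>'. mats \<rho>' = mats \<rho> \<and>
        scal \<rho>' J = j \<and> scal \<rho>' Rprev = scal \<rho> Rprev \<and> scal \<rho>' R = rows j)"
      using stored space[of "Suc j" j] j Inv
      by (intro compute_rows_correct) (auto simp: Inv_def)
    fix \<rho>\<^sub>1 :: store
    assume 1: "mats \<rho>\<^sub>1 = mats \<rho> \<and> scal \<rho>\<^sub>1 J = j \<and> scal \<rho>\<^sub>1 Rprev = scal \<rho> Rprev \<and>
      scal \<rho>\<^sub>1 R = rows j"
    show "achieves inp (compute_X ;; compute_P ;; J ::= Minus (Var J) (Num 1)) \<rho>\<^sub>1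
        (10 * rows j + (25 * (rows j * \<tau>) + 2)) bound (Inv (Suc i))"
    proof (rule achieves_Seq)
      have "stored \<rho>\<^sub>1 = stored \<rho>" using 1 by (simp add: stored_eq)
      then show "achieves inp compute_X \<rho>\<^sub>1 (10 * rows j) bound
          (\<lambda>\<rho>'. mats \<rho>' = (mats \<rho>\<^sub>1)(MX := X_mat j) \<and> scal \<rho>' J = j \<and>
            scal \<rho>' Rprev = scal \<rho>\<^sub>1 Rprev \<and> scal \<rho>' R = rows j)"
        using stored space[of "Suc j" j] j Inv 1
        by (intro compute_X_correct) (auto simp: Inv_def)
      fix \<rho>\<^sub>2 :: store
      assume 2: "mats \<rho>\<^sub>2 = (mats \<rho>\<^sub>1)(MX := X_mat j) \<and> scal \<rho>\<^sub>2 J = j \<and>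
        scal \<rho>\<^sub>2 Rprev = scal \<rho>\<^sub>1 Rprev \<and> scal \<rho>\<^sub>2 R = rows j"
      show "achieves inp (compute_P ;; J ::= Minus (Var J) (Num 1)) \<rho>\<^sub>2
          (25 * (rows j * \<tau>) + 2) bound (Inv (Suc i))"
      proof (rule achieves_Seq)
        have "stored \<rho>\<^sub>2 = stored \<rho> + rows j"
          using 1 2 Inv by (simp add: stored_eq Inv_def X_mat_def)
        then show "achieves inp compute_P \<rho>\<^sub>2 (25 * (rows j * \<tau>)) bound
            (\<lambda>\<rho>'. mats \<rho>' MX = 0\<^sub>m 0 0 \<and> mats \<rho>' MP = partial_product j \<and> mats \<rho>' MQ = 0\<^sub>m 0 0 \<and>
              scal \<rho>' J = j \<and> scal \<rho>' Rprev = rows j)"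
          using stored space[of "Suc j" j] i j Inv 1 2
          by (intro compute_P_correct) (auto simp: Inv_def)
        fix \<rho>\<^sub>3 :: store
        assume 3: "mats \<rho>\<^sub>3 MX = 0\<^sub>m 0 0 \<and> mats \<rho>\<^sub>3 MP = partial_product j \<and> mats \<rho>\<^sub>3 MQ = 0\<^sub>m 0 0 \<and>
          scal \<rho>\<^sub>3 J = j \<and> scal \<rho>\<^sub>3 Rprev = rows j"
        \<comment> \<open>After \<open>J\<close> is decremented, the product just computed is the
          \<open>P_{J+1}\<close> of the next round.\<close>
        have "Suc (S - Suc i) = j" using i j by simp
        moreover have pr: "partial_rows j = rows j" using j by (simp add: partial_rows_def)
        moreover have "stored \<rho>\<^sub>3 = 6 + rows j * \<tau>"
          using 3 pr by (simp add: stored_eq)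
        moreover from this have "stored \<rho>\<^sub>3 + 1 \<le> bound" using space[of j j] by linarith
        ultimately show "achieves inp (J ::= Minus (Var J) (Num 1)) \<rho>\<^sub>3 2 bound (Inv (Suc i))"
          using 3 i j
          by (intro achieves_Assign) (auto simp: Inv_def)
      qed simp
    qed simp
  next
    \<comment> \<open>The four commands of a round give 8 + 10 + 25 + 2 = 45.\<close>
    have "rows j \<le> rows j * \<tau>" using tau_pos by simp
    then show "8 * rows j + (10 * rows j + (25 * (rows j * \<tau>) + 2)) \<le> 45 * (rows j * \<tau>)"
      using rows_pos[of j] by linarith
  qed
  have sum_rows: "(\<Sum>i<S. rows (S - i)) = (\<Sum>j=1..S. rows j)"
    by (rule sum.reindex_bij_witness[of _ "\<lambda>j. S - j" "\<lambda>i. S - i"]) auto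
  have S_le: "S \<le> (\<Sum>j=1..S. rows j)"
    using sum_mono[of "{1..S}" "\<lambda>_. 1" rows] rows_pos by (simp add: Suc_leI)
  also have "\<dots> \<le> \<tau> * (\<Sum>j=1..S. rows j)" using tau_pos by simp
  finally have S_le_tau: "S \<le> \<tau> * (\<Sum>j=1..S. rows j)" .
  have tau_le: "\<tau> \<le> \<tau> * (\<Sum>j=1..S. rows j)" using S_le s_star by simp
  show ?thesis
    unfolding fast_program_def
  proof (rule achieves_Seq)
    show "achieves inp find_s_star empty_store (6 * S) bound
        (\<lambda>\<sigma>'. mats \<sigma>' = mats empty_store \<and> scal \<sigma>' J = S)"
      by (rule find_s_star_correct) (simp add: empty_store_def)
    fix \<rho> :: store
    assume \<rho>: "mats \<rho> = mats empty_store \<and> scal \<rho> J = S"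
    show "achieves inp (New MP (Num 1) InTau ;; Rprev ::= Num 1 ;; While (Less (Num 0) (Var J)) ?body)
        \<rho> (\<tau> + (1 + (45 * (\<tau> * (\<Sum>j=1..S. rows j)) + S + 1))) bound
        (\<lambda>\<sigma>. mats \<sigma> MP = partial_product 1)"
    proof (rule achieves_Seq)
      show "achieves inp (New MP (Num 1) InTau) \<rho> \<tau> bound
          (\<lambda>\<rho>. mats \<rho> = (\<lambda>_. 0\<^sub>m 0 0)(MP := 0\<^sub>m 1 \<tau>) \<and> scal \<rho> J = S)"
        using \<rho> space_init by (intro achieves_New) (auto simp: empty_store_def stored_eq)
      fix \<rho> :: store
      assume \<rho>: "mats \<rho> = (\<lambda>_. 0\<^sub>m 0 0)(MP := 0\<^sub>m 1 \<tau>) \<and> scal \<rho> J = S"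
      show "achieves inp (Rprev ::= Num 1 ;; While (Less (Num 0) (Var J)) ?body) \<rho>
          (1 + (45 * (\<tau> * (\<Sum>j=1..S. rows j)) + S + 1)) bound
          (\<lambda>\<sigma>. mats \<sigma> MP = partial_product 1)"
      proof (rule achieves_Seq)
        show "achieves inp (Rprev ::= Num 1) \<rho> 1 bound (Inv 0)"
          using \<rho> space_init by (intro achieves_Assign)
            (auto simp: Inv_def stored_eq partial_product_end partial_rows_def)
        fix \<rho> :: store
        assume "Inv 0 \<rho>"
        then show "achieves inp (While (Less (Num 0) (Var J)) ?body) \<rho>
            (45 * (\<tau> * (\<Sum>j=1..S. rows j)) + S + 1) bound (\<lambda>\<sigma>. mats \<sigma> MP = partial_product 1)"
        proof (rule achieves_While[where n = S and T = "\<lambda>i. 45 * (rows (S - i) * \<tau>)"])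
          fix i \<rho>
          assume "i < S" "Inv i \<rho>"
          then show "bval inp \<rho> (Less (Num 0) (Var J)) \<and>
              achieves inp ?body \<rho> (45 * (rows (S - i) * \<tau>)) bound (Inv (Suc i))"
            using body[of i "S - i" \<rho>] by (simp add: Inv_def)
        next
          fix i \<rho>
          assume "Inv i \<rho>"
          then show "stored \<rho> + bops (Less (Num 0) (Var J)) \<le> bound"
            using space[of "Suc (S - i)" 1] by (simp add: Inv_def stored_eq)
        next
          have "(\<Sum>i<S. 45 * (rows (S - i) * \<tau>)) = 45 * (\<tau> * (\<Sum>j=1..S. rows j))"
            by (simp add: sum_rows mult_ac flip: sum_distrib_left sum_distrib_right)
          then show "(\<Sum>i<S. 45 * (rows (S - i) * \<tau>) + bops (Less (Num 0) (Var J)))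
              + bops (Less (Num 0) (Var J)) \<le> 45 * (\<tau> * (\<Sum>j=1..S. rows j)) + S + 1"
            unfolding sum.distrib by simp
        qed (auto simp: Inv_def)
      qed simp
    qed simp
  next
    \<comment> \<open>Beyond the 45 from the rounds, \<open>7 * S + \<tau> + 2\<close> is at most 10
      times the same product, since \<open>S\<close>, \<open>\<tau>\<close> and 1 are each bounded
      by it.\<close>
    show "6 * S + (\<tau> + (1 + (45 * (\<tau> * (\<Sum>j=1..S. rows j)) + S + 1)))
        \<le> 60 * (\<tau> * (\<Sum>j=1..S. rows j))"
      using S_le_tau tau_le tau_pos by linarith
  qed
qed

text \<open>For \<open>j <= S\<close> the subtraction \<open>m - w j\<close> does not truncate, so
  \<open>rows j\<close> is the true quotient of \<open>b ^ m\<close> by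
  \<open>b ^ w j\<close>.\<close>

lemma sum_rows_real: "real (\<Sum>j=1..S. rows j) = real (b ^ m) * (\<Sum>j=1..S. 1 / real (b ^ w j))"
proof -
  have "real (rows j) = real (b ^ m) * (1 / real (b ^ w j))" if "j \<in> {1..S}" for j
    using that w_less[of j] b_ge2 power_diff[of "real b" "w j" m] by (simp add: rows_def)
  then show ?thesis by (simp add: sum_distrib_left)
qed

end

theorem theorem2:
  shows "\<exists>C\<^sub>o\<^sub>p > (0::real). \<exists>C\<^sub>s\<^sub>t > (0::real).
    \<forall>(s::nat) (\<tau>::nat) (A::real mat) (m::nat) (b::nat) (w::nat \<Rightarrow> nat) (z::nat \<Rightarrow> nat).
      s \<ge> 1 \<longrightarrow> \<tau> \<ge> 1 \<longrightarrow> A \<in> carrier_mat s \<tau> \<longrightarrow> m \<ge> 1 \<longrightarrow> prime b \<longrightarrow>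
      w 1 = 0 \<longrightarrow> mono_on {1..s} w \<longrightarrow>
      (\<forall>j\<in>{1..s}. z j \<in> reduced_units b m (w j)) \<longrightarrow>
      (\<exists>ops mem \<sigma>.
         run \<lparr>in_b = b, in_m = m, in_s = s, in_tau = \<tau>, in_w = w, in_z = z, in_A = A\<rparr>
           fast_program empty_store ops mem \<sigma> \<and>
         mats \<sigma> MP = fast_product b m s \<tau> w z A \<and>
         fast_product b m s \<tau> w z A = reduced_lattice_matrix b m s w z * A \<and>
         real ops \<le> C\<^sub>o\<^sub>p * (real \<tau> * real (b ^ m) * (\<Sum>j = 1..s_star m s w. 1 / real (b ^ w j))) \<and>
         real mem \<le> C\<^sub>s\<^sub>t * (real (b ^ m) * real \<tau>))"
proof (rule exI[of _ 60], rule conjI, simp, rule exI[of _ 20], rule conjI, simp, intro allI impI)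
  fix s \<tau> :: nat and A :: "real mat" and m b :: nat and w z :: "nat \<Rightarrow> nat"
  assume "s \<ge> 1" "\<tau> \<ge> 1" "A \<in> carrier_mat s \<tau>" "m \<ge> 1" "prime b" "w 1 = 0" "mono_on {1..s} w"
  then interpret reduced_lattice s \<tau> A m b w z
    by unfold_locales (auto dest: prime_ge_2_nat)
  \<comment> \<open>The witnesses 60 and 20 are the constants in \<open>fast_program_correct\<close>
    and \<open>bound\<close>.\<close>
  obtain ops mem \<sigma> where run: "run inp fast_program empty_store ops mem \<sigma>"
    and ops: "ops \<le> 60 * (\<tau> * (\<Sum>j=1..S. rows j))" and mem: "mem \<le> bound"
    and \<sigma>: "mats \<sigma> MP = partial_product 1"
    using fast_program_correct unfolding achieves_def by blast
  have "real ops \<le> real (60 * (\<tau> * (\<Sum>j=1..S. rows j)))"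
    using ops of_nat_mono by blast
  then have "real ops \<le> 60 * (real \<tau> * real (\<Sum>j=1..S. rows j))"
    by (simp only: of_nat_mult of_nat_numeral)
  then have "real ops \<le> 60 * (real \<tau> * real (b ^ m) * (\<Sum>j=1..S. 1 / real (b ^ w j)))"
    by (simp only: sum_rows_real mult.assoc)
  moreover have "real mem \<le> real bound"
    using mem of_nat_mono by blast
  then have "real mem \<le> 20 * (real (b ^ m) * real \<tau>)"
    by (simp only: bound_def of_nat_mult of_nat_numeral)
  ultimately show "\<exists>ops mem \<sigma>. run inp fast_program empty_store ops mem \<sigma> \<and>
      mats \<sigma> MP = fast_product b m s \<tau> w z A \<and>
      fast_product b m s \<tau> w z A = reduced_lattice_matrix b m s w z * A \<and>
      real ops \<le> 60 * (real \<tau> * real (b ^ m) * (\<Sum>j=1..S. 1 / real (b ^ w j))) \<and>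
      real mem \<le> 20 * (real (b ^ m) * real \<tau>)"
    using run \<sigma> fast_product_eq partial_product_1 by metis
qed

end
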